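(* Let $H$ be a Hilbert space and let $A: H\to H$ be a bounded linear operator with adjoint $A^*$. (I) If $A=B+F$, where $B$ is an isomorphism of $H$ and $F$ is a finite-rank operator on $H$, then $A$ is Fredholm. (II) If $A$ is Fredholm, then the following alternative holds: 1) either the equation $Au_0=0$ has only the trivial solution $u_0=0$, and then the equation $A^*v_0=0$ has only the trivial solution $v_0=0$, and the equations $Au=f$ and $A^*v=g$ are uniquely solvable for all right-hand sides $f\in H$ and $g\in H$; or 2) the equation $Au_0=0$ has exactly $n>0$ linearly independent solutions $\phi_1,\dots,\phi_n$ (that is, $\dim N(A)=n$ with $0<n<\infty$ and $\{\phi_j\}_{1\le j\le n}$ is a basis of $N(A)$), and then the equation $A^*v_0=0$ also has exactly $n$ linearly independent solutions $\psi_1,\dots,\psi_n$ (that is, $\dim N(A^* )=n$ and $\{\psi_j\}_{1\le j\le n}$ is a basis of $N(A^* )$). In this case, for $f\in H$, the equation $Au=f$ is solvable if and only if $(f,\psi_j)=0$ for all $1\le j\le n$; and, for $g\in H$, the equation $A^*v=g$ is solvable if and only if $(g,\phi_j)=0$ for all $1\le j\le n$. If they are solvable, their solutions are not unique, and their general solutions are, respectively, $u=u_p+\sum_{j=1}^n a_j\phi_j$ and $v=v_p+\sum_{j=1}^n b_j\psi_j$, where $a_j$ and $b_j$ are arbitrary constants (scalars), and $u_p$ and $v_p$ are some particular solutions of $Au=f$ and $A^*v=g$, respectively.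
   Context: $H$ is a Hilbert space with inner product $(\cdot,\cdot)$. For a bounded linear operator $A$ on $H$, $A^*$ denotes its adjoint, $N(A)$ its null-space and $R(A)$ its range. An isomorphism is a bounded linear operator $B$ on $H$ that is a bicontinuous injection of $H$ onto $H$, i.e. $B^{-1}$ is defined on all of $H$ and is bounded. A finite-rank operator is a (bounded linear) operator $F$ on $H$ with $\dim R(F)<\infty$. A bounded linear operator $A$ on $H$ is called Fredholm if and only if $\dim N(A)=\dim N(A^* )<\infty$ and both $R(A)$ and $R(A^* )$ are closed subspaces of $H$. (Note that equality of the two dimensions is part of the definition.) *)

theory Defs
  imports "HOL-Analysis.Analysis"
begin

text \<open>
  The scalar field of a Hilbert space is the real or the complex numbers. The class below treats
  both cases at once; \<open>conjugate\<close> is the identity on the reals and complex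
  conjugation on the complex numbers.
\<close>

class real_complex_field = real_normed_field + banach +
  fixes conjugate :: "'a \<Rightarrow> 'a"
  assumes conjugate_add: "conjugate (x + y) = conjugate x + conjugate y"
    and conjugate_mult: "conjugate (x * y) = conjugate x * conjugate y"
    and conjugate_conjugate: "conjugate (conjugate x) = x"
    and mult_conjugate: "x * conjugate x = (norm x)\<^sup>2 *\<^sub>R 1"
    and conjugate_fixed_imp_real: "conjugate x = x \<Longrightarrow> \<exists>r. x = r *\<^sub>R 1"

instantiation real :: real_complex_field
begin

definition conjugate_real :: "real \<Rightarrow> real" where
  "conjugate_real x = x"

instance
  by standard (simp_all add: conjugate_real_def power2_eq_square)

end

instantiation complex :: real_complex_field
begin

definition conjugate_complex :: "complex \<Rightarrow> complex" where
  "conjugate_complex = cnj"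

instance
proof
  fix x :: complex
  show "x * conjugate x = (norm x)\<^sup>2 *\<^sub>R 1"
    using complex_norm_square[of x] by (simp add: conjugate_complex_def scaleR_conv_of_real)
  show "conjugate x = x \<Longrightarrow> \<exists>r. x = r *\<^sub>R 1"
    by (auto simp: conjugate_complex_def scaleR_conv_of_real Reals_cnj_iff[symmetric] elim: Reals_cases)
qed (simp_all add: conjugate_complex_def)

end

text \<open>
  The inner product is linear in its first argument. Completeness, and the topology, come from the
  class \<^class>\<open>banach\<close>: the norm of the type is required to be the one
  induced by the inner product, which also makes the inner product positive definite, and the real
  scalar multiplication of the type to be the restriction of \<open>scale\<close>.
\<close>

locale hilbert_space = vector_space scale
  for scale :: "'k::real_complex_field \<Rightarrow> 'a::banach \<Rightarrow> 'a" +
  fixes ip :: "'a \<Rightarrow> 'a \<Rightarrow> 'k"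
  assumes scale_of_real: "scale (of_real r) x = r *\<^sub>R x"
    and ip_add_left: "ip (x + y) z = ip x z + ip y z"
    and ip_scale_left: "ip (scale c x) y = c * ip x y"
    and ip_conjugate: "ip y x = conjugate (ip x y)"
    and ip_self: "ip x x = of_real ((norm x)\<^sup>2)"
begin

definition bounded_operator :: "('a \<Rightarrow> 'a) \<Rightarrow> bool" where
  "bounded_operator A \<longleftrightarrow>
     Vector_Spaces.linear scale scale A \<and> (\<exists>K. \<forall>x. norm (A x) \<le> K * norm x)"

text \<open>
  The description is meaningful for every bounded operator: uniqueness is clear, and existence is
  the Riesz representation theorem.
\<close>

definition adjoint :: "('a \<Rightarrow> 'a) \<Rightarrow> 'a \<Rightarrow> 'a" where
  "adjoint A = (THE A'. \<forall>x y. ip (A x) y = ip x (A' y))"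

definition null_space :: "('a \<Rightarrow> 'a) \<Rightarrow> 'a set" where
  "null_space A = {u. A u = 0}"

text \<open>
  Needed besides \<^const>\<open>dim\<close>, which is 0 on infinite-dimensional subspaces.
\<close>

definition finite_dim :: "'a set \<Rightarrow> bool" where
  "finite_dim S \<longleftrightarrow> (\<exists>b. finite b \<and> S \<subseteq> span b)"

definition isomorphism :: "('a \<Rightarrow> 'a) \<Rightarrow> bool" where
  "isomorphism B \<longleftrightarrow> bounded_operator B \<and> bij B \<and> bounded_operator (inv B)"

definition finite_rank :: "('a \<Rightarrow> 'a) \<Rightarrow> bool" where
  "finite_rank F \<longleftrightarrow> bounded_operator F \<and> finite_dim (range F)"

definition fredholm :: "('a \<Rightarrow> 'a) \<Rightarrow> bool" where
  "fredholm A \<longleftrightarrow> bounded_operator A \<and>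
     finite_dim (null_space A) \<and> finite_dim (null_space (adjoint A)) \<and>
     dim (null_space A) = dim (null_space (adjoint A)) \<and>
     closed (range A) \<and> closed (range (adjoint A))"

definition is_basis :: "nat \<Rightarrow> (nat \<Rightarrow> 'a) \<Rightarrow> 'a set \<Rightarrow> bool" where
  "is_basis n \<phi> S \<longleftrightarrow>
     inj_on \<phi> {1..n} \<and> independent (\<phi> ` {1..n}) \<and> span (\<phi> ` {1..n}) = S"

end

lemma hilbert_space_real_inner:
  "hilbert_space scaleR (inner :: 'a::{real_inner,banach} \<Rightarrow> 'a \<Rightarrow> real)"
  by standard
    (simp_all add: scaleR_add_right scaleR_add_left inner_add_left inner_add_right inner_commute
      conjugate_real_def power2_norm_eq_inner)

lemma hilbert_space_complex: "hilbert_space (*) (\<lambda>x y :: complex. x * cnj y)"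
  by standard
    (simp_all add: algebra_simps conjugate_complex_def scaleR_conv_of_real
      complex_norm_square[symmetric])

end

theory Submission
  imports Defs
begin

text \<open>
  For \<open>A = B + F\<close> write \<open>A = B T\<close> with \<open>T = I + K\<close> and \<open>K = B\<^sup>-\<^sup>1 F\<close>. The finite-dimensional
  range \<open>V\<close> of \<open>K\<close> contains \<open>N(T) = N(A)\<close> and is mapped into itself by \<open>T\<close>, so rank-nullity gives
  \<open>C\<close> with \<open>dim N(A)\<close> elements such that \<open>V = T V + span C\<close>. Since \<open>x = T x - K x\<close>, it follows
  that \<open>H = R(A) + B (span C)\<close>, hence \<open>dim N(A*) \<le> dim N(A)\<close>, because \<open>N(A*)\<close> is the orthogonal
  complement of \<open>R(A)\<close>. The adjoint \<open>A* = B* + F*\<close> has the same form and \<open>A** = A\<close>, so equality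
  holds. The range of \<open>A\<close> is closed because it is the sum of \<open>B N(F)\<close>, which is closed, and a
  finite-dimensional subspace. The alternative then rests on \<open>R(A)\<close> being the orthogonal complement
  of \<open>N(A*)\<close> whenever \<open>R(A)\<close> is closed.
\<close>

section \<open>Conjugation in the scalar field\<close>

lemma conjugate_zero: "conjugate (0::'k::real_complex_field) = 0"
  using conjugate_add[of "0::'k" 0] by simp

text \<open>Take norms in \<open>mult_conjugate\<close> and cancel the factor
  \<open>norm x\<close>.\<close>

lemma norm_conjugate: "norm (conjugate x) = norm (x::'k::real_complex_field)"
proof (cases "x = 0")
  case True
  then show ?thesis by (simp add: conjugate_zero)
next
  case False
  have "norm x * norm (conjugate x) = norm x * norm x"
    by (simp add: mult_conjugate power2_eq_square flip: norm_mult)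
  with False show ?thesis by simp
qed

lemma conjugate_eq_zero_iff: "conjugate x = 0 \<longleftrightarrow> x = (0::'k::real_complex_field)"
  by (metis norm_conjugate norm_eq_zero)

context hilbert_space
begin

section \<open>Inner product geometry\<close>

lemma ip_zero_left [simp]: "ip 0 y = 0"
  using ip_add_left[of 0 0 y] by simp

lemma ip_zero_right [simp]: "ip x 0 = 0"
  using ip_conjugate[of x 0] by (simp add: conjugate_zero)

lemma ip_add_right: "ip x (y + z) = ip x y + ip x z"
  using ip_conjugate[of x "y + z"] ip_conjugate[of x y] ip_conjugate[of x z]
  by (simp add: ip_add_left conjugate_add)

lemma ip_scale_right: "ip x (scale c y) = conjugate c * ip x y"
  using ip_conjugate[of x "scale c y"] ip_conjugate[of x y]
  by (simp add: ip_scale_left conjugate_mult)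

lemma ip_diff_left: "ip (x - y) z = ip x z - ip y z"
  using ip_add_left[of "x - y" y z] by (simp add: algebra_simps)

lemma ip_diff_right: "ip x (y - z) = ip x y - ip x z"
  using ip_add_right[of x "y - z" z] by (simp add: algebra_simps)

lemma ip_self_eq_zero_iff [simp]: "ip x x = 0 \<longleftrightarrow> x = 0"
  by (simp add: ip_self)

lemma ip_eq_zero_commute: "ip x y = 0 \<longleftrightarrow> ip y x = 0"
  by (metis ip_conjugate conjugate_eq_zero_iff)

lemma ip_left_eqI:
  assumes "\<And>x. ip x u = ip x v"
  shows "u = v"
proof -
  have "ip (u - v) (u - v) = 0"
    using assms[of "u - v"] by (simp add: ip_diff_right)
  then show ?thesis by simp
qed

text \<open>The norm of the type is a priori homogeneous only for real scalars. For scalars in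
  \<open>'k\<close> this follows from \<open>ip_self\<close>, because \<open>ip\<close> turns the
  two copies of \<open>c\<close> into \<open>c * conjugate c\<close>.\<close>

lemma norm_scale: "norm (scale c x) = norm c * norm x"
proof -
  have "(of_real ((norm (scale c x))\<^sup>2) :: 'k) = of_real ((norm c * norm x)\<^sup>2)"
    using mult_conjugate[of c] unfolding ip_self[symmetric] ip_scale_left ip_scale_right
    by (simp add: ip_self scaleR_conv_of_real power_mult_distrib mult.commute
        flip: mult.assoc)
  then show ?thesis by (simp only: of_real_eq_iff power2_eq_iff_nonneg norm_ge_zero mult_nonneg_nonneg)
qed

lemma norm_add_square_orthogonal:
  assumes "ip x y = 0"
  shows "(norm (x + y))\<^sup>2 = (norm x)\<^sup>2 + (norm y)\<^sup>2"
proof -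
  have "(of_real ((norm (x + y))\<^sup>2) :: 'k) = of_real ((norm x)\<^sup>2 + (norm y)\<^sup>2)"
    unfolding of_real_add ip_self[symmetric]
    using assms ip_eq_zero_commute[of x y] by (simp add: ip_add_left ip_add_right)
  then show ?thesis by (simp only: of_real_eq_iff)
qed

lemma parallelogram_law:
  fixes x y :: 'a
  shows "(norm (x + y))\<^sup>2 + (norm (x - y))\<^sup>2 = 2 * (norm x)\<^sup>2 + 2 * (norm y)\<^sup>2"
proof -
  have "(of_real ((norm (x + y))\<^sup>2 + (norm (x - y))\<^sup>2) :: 'k) =
      of_real (2 * (norm x)\<^sup>2 + 2 * (norm y)\<^sup>2)"
    unfolding of_real_add of_real_mult ip_self[symmetric]
    by (simp add: ip_add_left ip_add_right ip_diff_left ip_diff_right)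
  then show ?thesis by (simp only: of_real_eq_iff)
qed

text \<open>Pythagoras for the component of \<open>x\<close> along \<open>y\<close>. It yields both
  the Cauchy-Schwarz inequality and the orthogonality of a distance minimizer.\<close>

lemma norm_square_diff_component:
  fixes x y :: 'a
  assumes "y \<noteq> 0"
  defines "c \<equiv> ip x y / ip y y"
  shows "ip (x - scale c y) y = 0"
    and "(norm x)\<^sup>2 = (norm (x - scale c y))\<^sup>2 + (norm c * norm y)\<^sup>2"
proof -
  show *: "ip (x - scale c y) y = 0"
    using assms by (simp add: ip_diff_left ip_scale_left)
  then have "ip (x - scale c y) (scale c y) = 0" by (simp add: ip_scale_right)
  from norm_add_square_orthogonal[OF this]
  show "(norm x)\<^sup>2 = (norm (x - scale c y))\<^sup>2 + (norm c * norm y)\<^sup>2"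
    by (simp add: norm_scale)
qed

text \<open>The component of \<open>x\<close> along \<open>y\<close> is no longer than
  \<open>x\<close> itself.\<close>

lemma Cauchy_Schwarz: "norm (ip x y) \<le> norm x * norm y"
proof (cases "y = 0")
  case False
  define c where "c = ip x y / ip y y"
  have "(norm c * norm y)\<^sup>2 \<le> (norm x)\<^sup>2"
    using norm_square_diff_component(2)[OF False, of x] unfolding c_def by simp
  then have "norm c * norm y \<le> norm x" by (simp add: power2_le_iff_abs_le)
  moreover have "norm c = norm (ip x y) / (norm y)\<^sup>2"
    unfolding c_def by (simp add: norm_divide ip_self norm_power)
  ultimately show ?thesis using False by (simp add: power2_eq_square field_simps)
qed simp

lemma bounded_linear_ip_left: "bounded_linear (\<lambda>x. ip x y)"
  by (rule bounded_linear_intro[where K = "norm y"])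
    (simp_all add: ip_add_left Cauchy_Schwarz ip_scale_left scaleR_conv_of_real flip: scale_of_real)

lemma bounded_linear_scale_left: "bounded_linear (\<lambda>c. scale c y)"
  by (rule bounded_linear_intro[where K = "norm y"])
    (simp_all add: scale_left_distrib norm_scale scaleR_conv_of_real scale_scale
      flip: scale_of_real)

section \<open>Orthogonal projection and the Riesz representation\<close>

text \<open>The projection \<open>p\<close> is the point of \<open>M\<close> nearest to
  \<open>x\<close>: completeness produces it, and minimality makes \<open>x - p\<close> orthogonal
  to \<open>M\<close>.\<close>

lemma orthogonal_projection_exists:
  assumes M: "subspace M" and cl: "closed M"
  obtains p where "p \<in> M" "\<And>y. y \<in> M \<Longrightarrow> ip (x - p) y = 0"
proof -
  define D where "D = (INF y\<in>M. (norm (x - y))\<^sup>2)"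
  have bdd: "bdd_below ((\<lambda>y. (norm (x - y))\<^sup>2) ` M)" by (rule bdd_belowI[of _ 0]) auto
  have ne: "M \<noteq> {}" using subspace_0[OF M] by auto
  have D_le: "D \<le> (norm (x - y))\<^sup>2" if "y \<in> M" for y
    unfolding D_def using bdd that by (rule cINF_lower)
  \<comment> \<open>By the parallelogram law the near-minimizers form nested closed sets of vanishing diameter.\<close>
  define S where "S n = {y \<in> M. (norm (x - y))\<^sup>2 \<le> D + 1 / real (Suc n)}" for n
  have "\<exists>a. \<forall>n. a \<in> S n"
  proof (rule decreasing_closed_nest)
    show "closed (S n)" for n
    proof -
      have "S n = M \<inter> {y. (norm (x - y))\<^sup>2 \<le> D + 1 / real (Suc n)}" by (auto simp: S_def)
      moreover have "closed {y. (norm (x - y))\<^sup>2 \<le> D + 1 / real (Suc n)}"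
        by (intro closed_Collect_le continuous_intros)
      ultimately show ?thesis using cl by auto
    qed
    show "S n \<noteq> {}" for n
    proof -
      have "D < D + 1 / real (Suc n)" by simp
      then obtain y where "y \<in> M" "(norm (x - y))\<^sup>2 < D + 1 / real (Suc n)"
        unfolding D_def using cINF_less_iff[OF ne bdd] by blast
      then have "y \<in> S n" by (simp add: S_def)
      then show ?thesis by blast
    qed
    show "S n \<subseteq> S m" if "m \<le> n" for m n
    proof -
      have "1 / real (Suc n) \<le> 1 / real (Suc m)" using that by (simp add: frac_le)
      then show ?thesis unfolding S_def by (blast intro: order_trans add_left_mono)
    qed
    show "\<exists>n. \<forall>y\<in>S n. \<forall>z\<in>S n. dist y z < e" if "e > 0" for e
    proof -
      have "e\<^sup>2 / 4 > 0" using that by simp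
      from reals_Archimedean[OF this] obtain n where n: "inverse (real (Suc n)) < e\<^sup>2 / 4" ..
      have "dist y z < e" if yz: "y \<in> S n" "z \<in> S n" for y z
      proof -
        \<comment> \<open>The midpoint of \<open>y\<close> and \<open>z\<close> lies in
          \<open>M\<close>, so its squared distance to \<open>x\<close> is at least
          \<open>D\<close>. The parallelogram law then gives
          \<open>(dist y z)\<^sup>2 \<le> 4 / Suc n\<close>, which explains the bound
          \<open>e\<^sup>2 / 4\<close> in the choice of \<open>n\<close>.\<close>
        define m where "m = scale (of_real (1/2)) (y + z)"
        have "m \<in> M" unfolding m_def using yz
          by (intro subspace_scale[OF M] subspace_add[OF M]) (auto simp: S_def)
        then have "D \<le> (norm (x - m))\<^sup>2" by (rule D_le)
        moreover have "(x - y) + (x - z) = 2 *\<^sub>R (x - m)"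
          unfolding m_def scale_of_real by (simp add: algebra_simps scaleR_2)
        then have "(norm ((x - y) + (x - z)))\<^sup>2 = 4 * (norm (x - m))\<^sup>2"
          by (simp add: power_mult_distrib)
        moreover have "norm ((x - y) - (x - z)) = dist y z"
          by (simp add: dist_norm norm_minus_commute)
        ultimately have "4 * D + (dist y z)\<^sup>2 \<le> 2 * (norm (x - y))\<^sup>2 + 2 * (norm (x - z))\<^sup>2"
          using parallelogram_law[of "x - y" "x - z"] by simp
        moreover have "(norm (x - y))\<^sup>2 \<le> D + inverse (real (Suc n))"
          "(norm (x - z))\<^sup>2 \<le> D + inverse (real (Suc n))"
          using yz by (simp_all add: S_def inverse_eq_divide)
        ultimately have "(dist y z)\<^sup>2 < e\<^sup>2"
          using n by linarith
        then show ?thesis using \<open>e > 0\<close> by (simp add: power2_less_imp_less)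
      qed
      then show ?thesis by blast
    qed
  qed blast
  then obtain p where p: "\<And>n. p \<in> S n" by blast
  have pM: "p \<in> M" using p[of 0] by (simp add: S_def)
  have "(norm (x - p))\<^sup>2 \<le> D"
  proof (rule field_le_epsilon)
    fix e :: real assume "e > 0"
    then obtain n where "inverse (real (Suc n)) < e" using reals_Archimedean by blast
    then show "(norm (x - p))\<^sup>2 \<le> D + e" using p[of n] by (simp add: S_def inverse_eq_divide)
  qed
  moreover have "ip (x - p) y = 0" if y: "y \<in> M" for y
  proof (cases "y = 0")
    case False
    \<comment> \<open>Moving from \<open>p\<close> to \<open>p + scale c y\<close> would lower the
      squared distance by \<open>(norm c * norm y)\<^sup>2\<close>, so minimality forces
      \<open>c = 0\<close>.\<close>
    define c where "c = ip (x - p) y / ip y y"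
    have "p + scale c y \<in> M" using pM y by (intro subspace_add[OF M] subspace_scale[OF M])
    from D_le[OF this] have "D \<le> (norm (x - p - scale c y))\<^sup>2" by (simp add: algebra_simps)
    with calculation norm_square_diff_component(2)[OF False, of "x - p"]
    have "(norm c * norm y)\<^sup>2 \<le> 0" unfolding c_def by linarith
    then show ?thesis using False by (simp add: c_def)
  qed simp
  ultimately show ?thesis using pM that by blast
qed

lemma orthogonal_decomposition:
  assumes "subspace M" "closed M"
  obtains p q where "x = p + q" "p \<in> M" "\<forall>y\<in>M. ip y q = 0"
proof -
  obtain p where "p \<in> M" "\<And>y. y \<in> M \<Longrightarrow> ip (x - p) y = 0"
    using orthogonal_projection_exists[OF assms] by blast
  then show ?thesis
    using that[of p "x - p"] ip_eq_zero_commute[of "x - p"] by simp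
qed

text \<open>The representing vector is a multiple of a vector orthogonal to the kernel of
  \<open>f\<close>. Since \<open>bounded_linear\<close> expresses linearity over the reals,
  homogeneity over \<open>'k\<close> is assumed separately.\<close>

lemma Riesz_representation:
  assumes bl: "bounded_linear f" and hom: "\<And>c x. f (scale c x) = c * f x"
  obtains w where "\<And>x. f x = ip x w"
proof (cases "\<forall>x. f x = 0")
  case True
  then show ?thesis using that[of 0] by simp
next
  case False
  then obtain x0 where x0: "f x0 \<noteq> 0" by blast
  interpret f: bounded_linear f by fact
  have sub: "subspace {x. f x = 0}" by (rule subspaceI) (simp_all add: f.add hom f.zero)
  have cl: "closed {x. f x = 0}"
    by (intro closed_Collect_eq linear_continuous_on bl continuous_on_const)
  obtain p z where pz: "x0 = p + z" "f p = 0" "\<And>y. f y = 0 \<Longrightarrow> ip y z = 0"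
    by (rule orthogonal_decomposition[OF sub cl, of x0]) simp
  have fz: "f z \<noteq> 0" using x0 pz by (simp add: f.add)
  then have z0: "ip z z \<noteq> 0" using f.zero by auto
  \<comment> \<open>The conjugate makes up for the conjugate-linearity of \<open>ip\<close> in its
    second argument. Subtracting \<open>scale (f x / f z) z\<close> from \<open>x\<close> lands in
    the kernel, to which \<open>z\<close> is orthogonal.\<close>
  have "f x = ip x (scale (conjugate (f z / ip z z)) z)" for x
  proof -
    have "f (x - scale (f x / f z) z) = 0" using fz by (simp add: f.diff hom)
    from pz(3)[OF this] have "ip x z = f x / f z * ip z z"
      by (simp add: ip_diff_left ip_scale_left)
    then show ?thesis using fz z0 by (simp add: ip_scale_right conjugate_conjugate)
  qed
  then show ?thesis by (rule that)
qed

section \<open>Bounded operators and adjoints\<close>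

lemma bounded_operator_linear:
  "bounded_operator A \<Longrightarrow> Vector_Spaces.linear scale scale A"
  by (simp add: bounded_operator_def)

text \<open>Continuity is obtained through the real notion \<open>bounded_linear\<close>;
  \<open>scale_of_real\<close> makes the passage from \<open>scale\<close>.\<close>

lemma bounded_operator_bounded_linear:
  assumes "bounded_operator A"
  shows "bounded_linear A"
proof -
  interpret A: Vector_Spaces.linear scale scale A
    using assms by (rule bounded_operator_linear)
  obtain K where "\<And>x. norm (A x) \<le> K * norm x" using assms by (auto simp: bounded_operator_def)
  then show ?thesis
    by (intro bounded_linear_intro[where K = K])
      (simp_all add: A.add A.scale mult.commute flip: scale_of_real)
qed

lemma bounded_operatorI:
  assumes "\<And>x y. A (x + y) = A x + A y" "\<And>c x. A (scale c x) = scale c (A x)"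
    "\<And>x. norm (A x) \<le> K * norm x"
  shows "bounded_operator A"
  unfolding bounded_operator_def using assms vector_space_axioms by (auto simp: Vector_Spaces.linear_iff)

lemma bounded_operator_add:
  assumes "bounded_operator A" "bounded_operator B"
  shows "bounded_operator (\<lambda>x. A x + B x)"
proof -
  interpret A: Vector_Spaces.linear scale scale A using assms bounded_operator_linear by blast
  interpret B: Vector_Spaces.linear scale scale B using assms bounded_operator_linear by blast
  obtain K L where "\<And>x. norm (A x) \<le> K * norm x" "\<And>x. norm (B x) \<le> L * norm x"
    using assms by (auto simp: bounded_operator_def)
  then have "norm (A x + B x) \<le> (K + L) * norm x" for x
    by (smt (verit) norm_triangle_ineq distrib_right)
  then show ?thesis
    by (intro bounded_operatorI[where K = "K + L"])
      (simp_all add: A.add B.add A.scale B.scale scale_right_distrib)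
qed

lemma adjoint_eqI:
  assumes "\<And>x y. ip (A x) y = ip x (A' y)"
  shows "adjoint A = A'"
  unfolding adjoint_def
proof (rule the_equality)
  fix A'' assume "\<forall>x y. ip (A x) y = ip x (A'' y)"
  then show "A'' = A'" using assms by (metis ip_left_eqI ext)
qed (use assms in blast)

text \<open>For each fixed \<open>y\<close> the functional \<open>\<lambda>x. ip (A x) y\<close> is
  bounded, so Riesz supplies the value at \<open>y\<close>. This is the existence that the
  description in \<open>adjoint\<close> relies on.\<close>

lemma ip_adjoint:
  assumes "bounded_operator A"
  shows "ip (A x) y = ip x (adjoint A y)"
proof -
  interpret A: Vector_Spaces.linear scale scale A using assms by (rule bounded_operator_linear)
  have "\<exists>w. \<forall>x. ip (A x) y = ip x w" for y
  proof -
    have "bounded_linear (\<lambda>x. ip (A x) y)"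
      using bounded_linear_compose[OF bounded_linear_ip_left bounded_operator_bounded_linear[OF assms]] .
    then show ?thesis using Riesz_representation[of "\<lambda>x. ip (A x) y"]
      by (metis A.scale ip_scale_left)
  qed
  then obtain A' where A': "\<And>x y. ip (A x) y = ip x (A' y)" by metis
  with adjoint_eqI[of A A'] show ?thesis by simp
qed

lemma ip_adjoint_left:
  assumes "bounded_operator A"
  shows "ip (adjoint A x) y = ip x (A y)"
  using ip_adjoint[OF assms, of y x] ip_conjugate by metis

lemma bounded_operator_adjoint:
  assumes "bounded_operator A"
  shows "bounded_operator (adjoint A)"
proof -
  obtain K where K: "\<And>x. norm (A x) \<le> norm x * K" and "K \<ge> 0"
    using bounded_linear.nonneg_bounded[OF bounded_operator_bounded_linear[OF assms]] by blast
  show ?thesis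
  proof (rule bounded_operatorI)
    show "adjoint A (x + y) = adjoint A x + adjoint A y" for x y
      by (rule ip_left_eqI) (simp add: ip_add_right flip: ip_adjoint[OF assms])
    show "adjoint A (scale c x) = scale c (adjoint A x)" for c x
      by (rule ip_left_eqI) (simp add: ip_scale_right flip: ip_adjoint[OF assms])
    \<comment> \<open>Cauchy-Schwarz bounds the square of the norm of \<open>?y\<close> by
      \<open>norm ?y * (K * norm x)\<close>; a factor \<open>norm ?y\<close> cancels, and for
      \<open>?y = 0\<close> the claim is \<open>0 \<le> K * norm x\<close>.\<close>
    show "norm (adjoint A x) \<le> K * norm x" for x
    proof -
      let ?y = "adjoint A x"
      have "(norm ?y)\<^sup>2 = norm (ip ?y ?y)" by (simp add: ip_self norm_power)
      also have "\<dots> = norm (ip (A ?y) x)" by (simp add: ip_adjoint[OF assms])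
      also have "\<dots> \<le> norm (A ?y) * norm x" by (rule Cauchy_Schwarz)
      also have "\<dots> \<le> norm ?y * K * norm x" by (intro mult_right_mono K) simp
      finally have "norm ?y * norm ?y \<le> norm ?y * (K * norm x)"
        by (simp add: power2_eq_square mult.assoc)
      then show ?thesis using \<open>K \<ge> 0\<close> by (cases "?y = 0") auto
    qed
  qed
qed

lemma adjoint_adjoint: "bounded_operator A \<Longrightarrow> adjoint (adjoint A) = A"
  by (rule adjoint_eqI) (rule ip_adjoint_left)

lemma adjoint_add:
  assumes "bounded_operator A" "bounded_operator B"
  shows "adjoint (\<lambda>x. A x + B x) = (\<lambda>x. adjoint A x + adjoint B x)"
  by (rule adjoint_eqI) (simp add: ip_add_left ip_add_right ip_adjoint assms)

text \<open>The inverse of \<open>adjoint B\<close> is \<open>adjoint (inv B)\<close>, checked by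
  moving both operators across the inner product.\<close>

lemma isomorphism_adjoint:
  assumes "isomorphism B"
  shows "isomorphism (adjoint B)"
proof -
  have B: "bounded_operator B" "bij B" "bounded_operator (inv B)"
    using assms by (auto simp: isomorphism_def)
  have "adjoint B (adjoint (inv B) y) = y" for y
    by (rule ip_left_eqI)
      (simp add: inv_f_f[OF bij_is_inj[OF B(2)]] flip: ip_adjoint[OF B(1)] ip_adjoint[OF B(3)])
  moreover have "adjoint (inv B) (adjoint B y) = y" for y
    by (rule ip_left_eqI)
      (simp add: surj_f_inv_f[OF bij_is_surj[OF B(2)]] flip: ip_adjoint[OF B(1)] ip_adjoint[OF B(3)])
  ultimately have "adjoint B \<circ> adjoint (inv B) = id" "adjoint (inv B) \<circ> adjoint B = id" by auto
  then have "bij (adjoint B)" "inv (adjoint B) = adjoint (inv B)"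
    by (auto intro: o_bij inv_unique_comp)
  then show ?thesis using B by (simp add: isomorphism_def bounded_operator_adjoint)
qed

section \<open>Null spaces and ranges\<close>

lemma subspace_null_space: "bounded_operator A \<Longrightarrow> subspace (null_space A)"
proof -
  assume "bounded_operator A"
  then interpret A: Vector_Spaces.linear scale scale A by (rule bounded_operator_linear)
  show ?thesis unfolding null_space_def by (rule A.subspace_kernel)
qed

lemma subspace_range: "bounded_operator A \<Longrightarrow> subspace (range A)"
proof -
  assume "bounded_operator A"
  then interpret A: Vector_Spaces.linear scale scale A by (rule bounded_operator_linear)
  show ?thesis by (rule A.subspace_image) (rule subspace_UNIV)
qed

lemma closed_null_space: "bounded_operator A \<Longrightarrow> closed (null_space A)"
  unfolding null_space_def
  by (intro closed_Collect_eq linear_continuous_on bounded_operator_bounded_linear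
      continuous_on_const)

lemma null_space_adjoint:
  assumes "bounded_operator A"
  shows "null_space (adjoint A) = {v. \<forall>y\<in>range A. ip y v = 0}"
  unfolding null_space_def
  by (auto simp: ip_adjoint[OF assms]) (metis ip_left_eqI ip_zero_right)

text \<open>Closedness allows \<open>f\<close> to be projected onto the range. The remainder
  \<open>q\<close> lies in the null space of the adjoint, so it is orthogonal to \<open>f\<close>
  and to the projection, hence to itself.\<close>

lemma range_eq_orthogonal_null_space_adjoint:
  assumes A: "bounded_operator A" and cl: "closed (range A)"
  shows "range A = {f. \<forall>v\<in>null_space (adjoint A). ip f v = 0}"
proof (intro equalityI subsetI CollectI ballI)
  fix f v assume "f \<in> range A" "v \<in> null_space (adjoint A)"
  then show "ip f v = 0" unfolding null_space_adjoint[OF A] by blast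
next
  fix f assume f: "f \<in> {f. \<forall>v\<in>null_space (adjoint A). ip f v = 0}"
  obtain p q where pq: "f = p + q" "p \<in> range A" "\<forall>y\<in>range A. ip y q = 0"
    by (rule orthogonal_decomposition[OF subspace_range[OF A] cl, of f]) (rule that)
  then have "q \<in> null_space (adjoint A)" by (simp add: null_space_adjoint[OF A])
  with f have "ip (p + q) q = 0" using pq(1) by simp
  then have "q = 0" using bspec[OF pq(3,2)] by (simp add: ip_add_left)
  then show "f \<in> range A" using pq by simp
qed

section \<open>Finite-dimensional subspaces\<close>

lemma finite_dim_basis:
  assumes "finite_dim S" "subspace S"
  obtains b where "finite b" "independent b" "b \<subseteq> S" "span b = S" "card b = dim S"
proof -
  obtain b where b: "b \<subseteq> S" "independent b" "S \<subseteq> span b" "card b = dim S"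
    by (rule basis_exists)
  obtain c where "finite c" "S \<subseteq> span c" using assms by (auto simp: finite_dim_def)
  then have "finite b" using independent_span_bound[of c b] b by blast
  moreover have "span b = S" using b span_minimal[OF b(1) assms(2)] by blast
  ultimately show ?thesis using that b by blast
qed

text \<open>Split \<open>v = p + w\<close> with \<open>p\<close> in \<open>M\<close> and
  \<open>w\<close> orthogonal to \<open>M\<close>. If \<open>w = 0\<close> the sum is
  \<open>M\<close>; otherwise it is the preimage of \<open>M\<close> under a continuous map.\<close>

lemma closed_sum_span_singleton:
  assumes M: "subspace M" and cl: "closed M"
  shows "closed {x + y |x y. x \<in> M \<and> y \<in> span {v}}"
proof -
  obtain p w where pw: "v = p + w" "p \<in> M" "\<forall>y\<in>M. ip y w = 0"
    by (rule orthogonal_decomposition[OF M cl, of v]) (rule that)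
  show ?thesis
  proof (cases "w = 0")
    case True
    then have "span {v} \<subseteq> M" using pw span_minimal[OF _ M, of "{v}"] by simp
    then have "{x + y |x y. x \<in> M \<and> y \<in> span {v}} = M"
      using subspace_add[OF M] span_zero[of "{v}"] by (auto, metis add.right_neutral)
    then show ?thesis using cl by simp
  next
    case False
    define P where "P x = x - scale (ip x w / ip w w) w" for x
    \<comment> \<open>\<open>P\<close> removes the component along \<open>w\<close>, and \<open>M + span {v} = M + span {w}\<close>.\<close>
    have "{x + y |x y. x \<in> M \<and> y \<in> span {v}} = P -` M"
    proof (intro equalityI subsetI)
      fix z assume "z \<in> {x + y |x y. x \<in> M \<and> y \<in> span {v}}"
      then obtain x c where z: "z = x + scale c v" "x \<in> M" by (auto simp: span_singleton)
      have "ip z w / ip w w = c"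
        using False pw z by (simp add: ip_add_left ip_scale_left)
      then have "P z = x + scale c p" unfolding P_def using z pw(1) by (simp add: scale_right_distrib)
      then show "z \<in> P -` M" using z pw by (simp add: subspace_add[OF M] subspace_scale[OF M])
    next
      fix z assume z: "z \<in> P -` M"
      define c where "c = ip z w / ip w w"
      have "z = (P z - scale c p) + scale c v"
        unfolding P_def c_def pw(1) by (simp add: scale_right_distrib)
      moreover have "P z - scale c p \<in> M"
        using z pw by (simp add: subspace_diff[OF M] subspace_scale[OF M])
      ultimately show "z \<in> {x + y |x y. x \<in> M \<and> y \<in> span {v}}"
        by (auto simp: span_singleton)
    qed
    moreover have "continuous_on UNIV P"
      unfolding P_def using False
      by (intro continuous_intros bounded_linear.continuous_on[OF bounded_linear_scale_left]
          linear_continuous_on[OF bounded_linear_ip_left]) simp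
    ultimately show ?thesis using closed_vimage[OF cl] by simp
  qed
qed

text \<open>Add one vector at a time. The induction hypothesis is applied to
  \<open>M + span {v}\<close>, so \<open>M\<close> must stay arbitrary.\<close>

lemma closed_sum_span:
  assumes "finite c" "subspace M" "closed M"
  shows "closed {x + y |x y. x \<in> M \<and> y \<in> span c}"
  using assms
proof (induction c arbitrary: M rule: finite_induct)
  case (insert v c)
  let ?M = "{x + y |x y. x \<in> M \<and> y \<in> span {v}}"
  have closed: "closed {x + y |x y. x \<in> ?M \<and> y \<in> span c}"
    using insert.prems by (intro insert.IH subspace_sums subspace_span closed_sum_span_singleton)
  have "span (insert v c) = {x + y |x y. x \<in> span {v} \<and> y \<in> span c}"
    using span_Un[of "{v}" c] by simp
  then have "{x + y |x y. x \<in> M \<and> y \<in> span (insert v c)} =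
      {x + (y + z) |x y z. x \<in> M \<and> y \<in> span {v} \<and> z \<in> span c}"
    by (simp only: mem_Collect_eq) blast
  also have "\<dots> = {x + y |x y. x \<in> ?M \<and> y \<in> span c}"
    unfolding add.assoc[symmetric] by blast
  finally show ?case using closed by simp
qed simp

lemma closed_finite_dim:
  assumes "finite_dim S" "subspace S"
  shows "closed S"
proof -
  obtain b where b: "finite b" "span b = S" using finite_dim_basis[OF assms] by blast
  have "closed {x + y |x y. x \<in> {0} \<and> y \<in> span b}"
    by (rule closed_sum_span[OF b(1)]) simp_all
  then show ?thesis using b by simp
qed

text \<open>\<open>adjoint F\<close> vanishes on the orthogonal complement of the range of
  \<open>F\<close>, so it takes all its values on that finite-dimensional range.\<close>

lemma finite_rank_adjoint:
  assumes "finite_rank F"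
  shows "finite_rank (adjoint F)"
proof -
  have F: "bounded_operator F" "finite_dim (range F)" using assms by (auto simp: finite_rank_def)
  note F' = bounded_operator_adjoint[OF F(1)]
  interpret F': Vector_Spaces.linear scale scale "adjoint F" using F' by (rule bounded_operator_linear)
  note sub = subspace_range[OF F(1)]
  obtain b where b: "finite b" "span b = range F" by (rule finite_dim_basis[OF F(2) sub]) (rule that)
  have "adjoint F x \<in> span (adjoint F ` b)" for x
  proof -
    obtain p q where pq: "x = p + q" "p \<in> range F" "\<forall>y\<in>range F. ip y q = 0"
      by (rule orthogonal_decomposition[OF sub closed_finite_dim[OF F(2) sub], of x]) (rule that)
    then have "q \<in> null_space (adjoint F)" by (simp add: null_space_adjoint[OF F(1)])
    then have "adjoint F x = adjoint F p" using pq by (simp add: F'.add null_space_def)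
    also have "\<dots> \<in> span (adjoint F ` b)" using pq(2) b(2) by (simp add: F'.span_image)
    finally show ?thesis .
  qed
  then have "finite_dim (range (adjoint F))"
    unfolding finite_dim_def using b(1) by (intro exI[of _ "adjoint F ` b"]) auto
  with F' show ?thesis by (simp add: finite_rank_def)
qed

section \<open>Finite-rank perturbations of isomorphisms\<close>

lemma closed_range_isomorphism_plus_finite_rank:
  assumes B: "isomorphism B" and F: "finite_rank F"
  shows "closed (range (\<lambda>x. B x + F x))"
proof -
  define A where "A = (\<lambda>x. B x + F x)"
  have bB: "bounded_operator B" "bij B" "bounded_operator (inv B)"
    using B by (auto simp: isomorphism_def)
  have bF: "bounded_operator F" "finite_dim (range F)" using F by (auto simp: finite_rank_def)
  have bA: "bounded_operator A" unfolding A_def by (rule bounded_operator_add[OF bB(1) bF(1)])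
  interpret A: Vector_Spaces.linear scale scale A using bA by (rule bounded_operator_linear)
  interpret B: Vector_Spaces.linear scale scale B using bB(1) by (rule bounded_operator_linear)
  interpret F: Vector_Spaces.linear scale scale F using bF(1) by (rule bounded_operator_linear)
  obtain b where b: "finite b" "span b = range F" "b \<subseteq> range F"
    by (rule finite_dim_basis[OF bF(2) subspace_range[OF bF(1)]]) (rule that)
  \<comment> \<open>The set \<open>c\<close> consists of preimages of a basis of the range of
    \<open>F\<close>. Every vector differs from some element of \<open>span c\<close> by an element
    of the null space of \<open>F\<close>, where \<open>A\<close> agrees with
    \<open>B\<close>.\<close>
  obtain c where c: "finite c" "b = F ` c" using finite_subset_image[OF b(1,3)] by blast
  \<comment> \<open>As a preimage under the continuous map \<open>inv B\<close>, the image is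
    closed.\<close>
  have "B ` null_space F = inv B -` null_space F"
    using bij_vimage_eq_inv_image[OF bij_imp_bij_inv[OF bB(2)]] inv_inv_eq[OF bB(2)] by simp
  then have "closed (B ` null_space F)"
    using closed_vimage[OF closed_null_space[OF bF(1)]
        linear_continuous_on[OF bounded_operator_bounded_linear[OF bB(3)]]] by simp
  moreover have "subspace (B ` null_space F)"
    by (rule B.subspace_image[OF subspace_null_space[OF bF(1)]])
  ultimately have "closed {x + y |x y. x \<in> B ` null_space F \<and> y \<in> span (A ` c)}"
    using c(1) by (intro closed_sum_span) auto
  moreover have "{x + y |x y. x \<in> B ` null_space F \<and> y \<in> span (A ` c)} = range A"
  proof (intro equalityI subsetI)
    fix z assume "z \<in> {x + y |x y. x \<in> B ` null_space F \<and> y \<in> span (A ` c)}"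
    then obtain x y where "z = B x + A y" "F x = 0"
      by (auto simp: A.span_image null_space_def)
    then have "z = A (x + y)" unfolding A.add by (simp add: A_def)
    then show "z \<in> range A" by simp
  next
    fix z assume "z \<in> range A"
    then obtain x where x: "z = A x" by blast
    have "F x \<in> F ` span c" using b(2) c(2) by (simp flip: F.span_image)
    then obtain y where y: "y \<in> span c" "F x = F y" by blast
    then have "F (x - y) = 0" by (simp add: F.diff)
    moreover have "z = A (x - y) + A y" using x by (simp add: A.diff)
    then have "z = B (x - y) + A y" using calculation by (simp add: A_def)
    ultimately show "z \<in> {x + y |x y. x \<in> B ` null_space F \<and> y \<in> span (A ` c)}"
      using y(1) by (auto simp: A.span_image null_space_def)
  qed
  ultimately show ?thesis by (simp add: A_def)
qed

section \<open>Dimension of the null space of the adjoint\<close>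

lemma independent_span_Int:
  assumes B: "independent B" and sub: "B1 \<subseteq> B" "B2 \<subseteq> B" and disj: "B1 \<inter> B2 = {}"
  shows "span B1 \<inter> span B2 = {0}"
proof -
  have "x = 0" if x: "x \<in> span B1" "x \<in> span B2" for x
  proof -
    \<comment> \<open>The coordinates over \<open>B\<close> are supported in \<open>B1\<close> and
      in \<open>B2\<close>, hence nowhere.\<close>
    have "representation B1 x = representation B x" "representation B2 x = representation B x"
      by (rule representation_extend[OF B, symmetric]; use x sub in blast)+
    then have "representation B x b = 0" for b
      using representation_ne_zero[of B1 x b] representation_ne_zero[of B2 x b] disj by auto
    then show "x = 0"
      using sum_nonzero_representation_eq[OF B, of x] x(1) span_mono[OF sub(1)] by auto
  qed
  then show ?thesis using span_zero by blast
qed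

text \<open>Extend a basis \<open>B1\<close> of the null space to a basis \<open>B\<close> of
  \<open>V\<close>. The images of \<open>B - B1\<close> stay independent and extend to a basis
  \<open>D\<close> of \<open>V\<close>; \<open>C\<close> consists of the vectors added
  there.\<close>

lemma rank_nullity_complement:
  assumes T: "Vector_Spaces.linear scale scale T"
    and V: "finite_dim V" "subspace V" and TV: "T ` V \<subseteq> V" and N: "null_space T \<subseteq> V"
  obtains C where "finite C" "card C = dim (null_space T)"
    "\<And>v. v \<in> V \<Longrightarrow> \<exists>x\<in>V. \<exists>y\<in>span C. v = T x + y"
proof -
  interpret T: Vector_Spaces.linear scale scale T by fact
  have subN: "subspace (null_space T)" unfolding null_space_def by (rule T.subspace_kernel)
  have fin: "finite E" if "independent E" "E \<subseteq> V" for E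
    using that V(1) independent_span_bound[of _ E] unfolding finite_dim_def by blast
  have "finite_dim (null_space T)" using V(1) N unfolding finite_dim_def by blast
  then obtain B1 where B1: "independent B1" "B1 \<subseteq> null_space T" "span B1 = null_space T"
      "card B1 = dim (null_space T)" "finite B1"
    using finite_dim_basis subN by blast
  obtain B where B: "B1 \<subseteq> B" "B \<subseteq> V" "independent B" "V \<subseteq> span B"
    using maximal_independent_subset_extend[OF _ B1(1), of V] B1(2) N by blast
  have finB: "finite B" using fin B by blast
  have inj: "inj_on T (span (B - B1))"
  proof (subst T.inj_on_iff_eq_0[OF subspace_span], intro ballI impI)
    fix x assume x: "x \<in> span (B - B1)" "T x = 0"
    then have "x \<in> span B1" using B1(3) by (simp add: null_space_def)
    moreover have "span (B - B1) \<inter> span B1 = {0}"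
      using independent_span_Int[OF B(3), of "B - B1" B1] B(1) by blast
    ultimately show "x = 0" using x by blast
  qed
  have ind: "independent (T ` (B - B1))"
    by (rule T.independent_injective_image[OF independent_mono[OF B(3) Diff_subset] inj])
  have card: "card (T ` (B - B1)) = card (B - B1)"
    by (rule card_image[OF inj_on_subset[OF inj span_superset]])
  have "T ` (B - B1) \<subseteq> V" using TV B(2) by blast
  then obtain D where D: "T ` (B - B1) \<subseteq> D" "D \<subseteq> V" "independent D" "V \<subseteq> span D"
    using maximal_independent_subset_extend[OF _ ind] by blast
  have finD: "finite D" using fin D by blast
  \<comment> \<open>Both bases of \<open>V\<close> have equal size, and \<open>T\<close> preserves
    the size of \<open>B - B1\<close>, so as many vectors were added to the images as
    \<open>B1\<close> contains.\<close>
  have "card D = dim V" using basis_card_eq_dim[OF D(2,4,3)] .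
  moreover have "card B = dim V" using basis_card_eq_dim[OF B(2,4,3)] .
  ultimately have "card (D - T ` (B - B1)) = card B1"
    using card finB finD B(1) D(1) B1(5) card_mono[OF finB B(1)]
    by (simp add: card_Diff_subset)
  moreover have "\<exists>x\<in>V. \<exists>y\<in>span (D - T ` (B - B1)). v = T x + y" if "v \<in> V" for v
  proof -
    have "D = T ` (B - B1) \<union> (D - T ` (B - B1))" using D(1) by blast
    then have "v \<in> span (T ` (B - B1) \<union> (D - T ` (B - B1)))" using that D(4) by auto
    then obtain s y where "v = s + y" "s \<in> span (T ` (B - B1))" "y \<in> span (D - T ` (B - B1))"
      unfolding span_Un by blast
    moreover have "span (B - B1) \<subseteq> V" using B(2) V(2) by (intro span_minimal) auto
    ultimately show ?thesis unfolding T.span_image by blast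
  qed
  ultimately show ?thesis using that[of "D - T ` (B - B1)"] finD B1(4) by simp
qed

text \<open>Modulo \<open>R\<close> the whole space is spanned by \<open>C\<close>, so the
  components of the elements of \<open>C\<close> orthogonal to \<open>R\<close> span the orthogonal
  complement.\<close>

lemma orthogonal_complement_dim_le:
  assumes R: "subspace R" "closed R" and C: "finite C"
    and sum: "\<And>x. \<exists>r\<in>R. \<exists>y\<in>span C. x = r + y"
  defines "N \<equiv> {v. \<forall>y\<in>R. ip y v = 0}"
  shows "finite_dim N" and "dim N \<le> card C"
proof -
  have "\<exists>q. x - q \<in> R \<and> (\<forall>y\<in>R. ip y q = 0)" for x
    by (rule orthogonal_decomposition[OF R, of x]) (metis add_diff_cancel_right')
  then obtain Q where Q: "\<And>x. x - Q x \<in> R" "\<And>x y. y \<in> R \<Longrightarrow> ip y (Q x) = 0" by metis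
  \<comment> \<open>\<open>Q\<close> comes from a choice, with no linearity established, so the
    comparison is made modulo \<open>R\<close> by induction over the span.\<close>
  have span_mod: "\<exists>z\<in>span (Q ` C). y - z \<in> R" if "y \<in> span C" for y
    using that
  proof (induction rule: span_induct_alt)
    case base
    show ?case using span_zero subspace_0[OF R(1)] by force
  next
    case (step c x y)
    then obtain z where z: "z \<in> span (Q ` C)" "y - z \<in> R" by blast
    have "scale c x + y - (scale c (Q x) + z) = scale c (x - Q x) + (y - z)"
      by (simp add: scale_right_diff_distrib)
    also have "\<dots> \<in> R" using z Q(1) R(1) by (intro subspace_add subspace_scale) auto
    finally have "scale c x + y - (scale c (Q x) + z) \<in> R" .
    moreover have "scale c (Q x) + z \<in> span (Q ` C)"
      using z(1) step.hyps by (intro span_add span_scale) (auto intro: span_base)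
    ultimately show ?case by blast
  qed
  have subN: "subspace N" unfolding N_def
    by (rule subspaceI) (auto simp: ip_add_right ip_scale_right)
  have QN: "span (Q ` C) \<subseteq> N" by (rule span_minimal[OF _ subN]) (auto simp: N_def Q)
  have sub: "N \<subseteq> span (Q ` C)"
  proof
    fix v assume v: "v \<in> N"
    obtain r y where ry: "r \<in> R" "y \<in> span C" "v = r + y" using sum by blast
    obtain z where z: "z \<in> span (Q ` C)" "y - z \<in> R" using span_mod[OF ry(2)] by blast
    \<comment> \<open>The difference lies both in \<open>R\<close> and in its orthogonal complement,
      so it is zero.\<close>
    have "v - z = r + (y - z)" using ry by simp
    then have "v - z \<in> R" using ry z subspace_add[OF R(1)] by metis
    moreover have "v - z \<in> N" using v z QN subspace_diff[OF subN] by blast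
    ultimately have "ip (v - z) (v - z) = 0" by (simp add: N_def)
    then show "v \<in> span (Q ` C)" using z by simp
  qed
  then show "finite_dim N" unfolding finite_dim_def using C by blast
  have "dim N \<le> card (Q ` C)" using sub C by (intro dim_le_card) auto
  also have "\<dots> \<le> card C" using C by (rule card_image_le)
  finally show "dim N \<le> card C" .
qed

lemma null_space_adjoint_dim_le:
  assumes B: "isomorphism B" and F: "finite_rank F"
  defines "A \<equiv> \<lambda>x. B x + F x"
  shows "finite_dim (null_space (adjoint A))"
    and "dim (null_space (adjoint A)) \<le> dim (null_space A)"
proof -
  have bB: "bounded_operator B" "bij B" "bounded_operator (inv B)"
    using B by (auto simp: isomorphism_def)
  have bF: "bounded_operator F" "finite_dim (range F)" using F by (auto simp: finite_rank_def)
  have bA: "bounded_operator A" unfolding A_def by (rule bounded_operator_add[OF bB(1) bF(1)])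
  interpret B: Vector_Spaces.linear scale scale B using bB(1) by (rule bounded_operator_linear)
  interpret B': Vector_Spaces.linear scale scale "inv B" using bB(3) by (rule bounded_operator_linear)
  interpret F: Vector_Spaces.linear scale scale F using bF(1) by (rule bounded_operator_linear)
  define K where "K x = inv B (F x)" for x
  define T where "T x = x + K x" for x
  have BB': "B (inv B x) = x" for x by (rule surj_f_inv_f[OF bij_is_surj[OF bB(2)]])
  have BT: "B (T x) = A x" for x by (simp add: T_def K_def A_def B.add BB')
  have linT: "Vector_Spaces.linear scale scale T"
    unfolding Vector_Spaces.linear_iff using vector_space_axioms
    by (simp add: algebra_simps T_def K_def F.add B'.add F.scale B'.scale scale_right_distrib)
  have "T x = 0 \<longleftrightarrow> A x = 0" for x
    using BT[of x] B.zero injD[OF bij_is_inj[OF bB(2)], of "T x" 0] by auto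
  then have NT: "null_space T = null_space A" by (simp add: null_space_def)
  define V where "V = inv B ` range F"
  have subV: "subspace V" unfolding V_def by (rule B'.subspace_image[OF subspace_range[OF bF(1)]])
  have KV: "K x \<in> V" for x by (simp add: V_def K_def)
  obtain b where b: "finite b" "span b = range F"
    by (rule finite_dim_basis[OF bF(2) subspace_range[OF bF(1)]]) (rule that)
  have finV: "finite_dim V" unfolding finite_dim_def V_def
    by (rule exI[of _ "inv B ` b"]) (simp add: b B'.span_image)
  have TV: "T ` V \<subseteq> V" unfolding T_def using KV subspace_add[OF subV] by auto
  have NV: "null_space T \<subseteq> V"
  proof
    fix x assume "x \<in> null_space T"
    then have "x = - K x" by (simp add: null_space_def T_def eq_neg_iff_add_eq_0)
    then show "x \<in> V" using KV subspace_neg[OF subV] by metis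
  qed
  obtain C where C: "finite C" "card C = dim (null_space T)"
      "\<And>v. v \<in> V \<Longrightarrow> \<exists>x\<in>V. \<exists>y\<in>span C. v = T x + y"
    using rank_nullity_complement[OF linT finV subV TV NV] by blast
  interpret T: Vector_Spaces.linear scale scale T by fact
  have sum: "\<exists>r\<in>range A. \<exists>y\<in>span (B ` C). x = r + y" for x
  proof -
    obtain v y where vy: "y \<in> span C" "K (inv B x) = T v + y" using C(3)[OF KV] by blast
    have "inv B x = T (inv B x - v) - y"
      using vy(2) by (simp add: T.diff) (simp add: T_def)
    then have "x = B (T (inv B x - v) - y)" using BB' by metis
    then have "x = A (inv B x - v) + - B y" by (simp add: B.diff BT)
    moreover have "- B y \<in> span (B ` C)" using vy(1) unfolding B.span_image[symmetric]
      by (intro span_neg) (simp add: B.span_image)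
    ultimately show ?thesis by blast
  qed
  have cl: "closed (range A)"
    unfolding A_def by (rule closed_range_isomorphism_plus_finite_rank[OF B F])
  note * = orthogonal_complement_dim_le[OF subspace_range[OF bA] cl finite_imageI[OF C(1)] sum]
  show "finite_dim (null_space (adjoint A))"
    unfolding null_space_adjoint[OF bA] by (rule *(1))
  have "dim (null_space (adjoint A)) \<le> card (B ` C)"
    unfolding null_space_adjoint[OF bA] by (rule *(2))
  also have "\<dots> \<le> card C" using C(1) by (rule card_image_le)
  finally show "dim (null_space (adjoint A)) \<le> dim (null_space A)" by (simp add: C(2) NT)
qed

lemma isomorphism_plus_finite_rank_fredholm:
  assumes B: "isomorphism B" and F: "finite_rank F"
  shows "fredholm (\<lambda>x. B x + F x)"
proof -
  have b: "bounded_operator B" "bounded_operator F"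
    using assms by (auto simp: isomorphism_def finite_rank_def)
  note bA = bounded_operator_add[OF b]
  note adj = adjoint_add[OF b]
  note assms' = isomorphism_adjoint[OF B] finite_rank_adjoint[OF F]
  note 1 = null_space_adjoint_dim_le[OF assms]
  \<comment> \<open>The same bound for the adjoint pair gives the reverse inequality and the finite
    dimension of the null space of \<open>A\<close>.\<close>
  note 2 = null_space_adjoint_dim_le[OF assms', folded adj, unfolded adjoint_adjoint[OF bA]]
  show ?thesis
    unfolding fredholm_def
    using bA 1 2 closed_range_isomorphism_plus_finite_rank[OF assms]
      closed_range_isomorphism_plus_finite_rank[OF assms', folded adj]
    by (auto intro: antisym)
qed

section \<open>The alternative\<close>

lemma fredholm_adjoint: "fredholm A \<Longrightarrow> fredholm (adjoint A)"
  by (auto simp: fredholm_def adjoint_adjoint bounded_operator_adjoint)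

lemma is_basis_exists:
  assumes "finite_dim S" "subspace S"
  shows "\<exists>\<phi>. is_basis (dim S) \<phi> S"
proof -
  obtain b where b: "finite b" "independent b" "span b = S" "card b = dim S"
    by (rule finite_dim_basis[OF assms]) (rule that)
  obtain \<phi> where "bij_betw \<phi> {1..card b} b" using ex_bij_betw_nat_finite_1[OF b(1)] by blast
  then have "is_basis (card b) \<phi> S"
    using b(2,3) by (simp add: is_basis_def bij_betw_def)
  then show ?thesis unfolding b(4) by blast
qed

lemma is_basis_combinations:
  assumes "is_basis n \<phi> S"
  shows "S = {\<Sum>j=1..n. scale (a j) (\<phi> j) |a. True}"
proof -
  have inj: "inj_on \<phi> {1..n}" and S: "S = span (\<phi> ` {1..n})" using assms by (auto simp: is_basis_def)
  show ?thesis
  proof (intro equalityI subsetI)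
    fix x assume "x \<in> S"
    then obtain c where "x = (\<Sum>v\<in>\<phi> ` {1..n}. scale (c v) v)"
      unfolding S by (auto simp: span_finite)
    \<comment> \<open>Injectivity of the enumeration turns the sum over basis vectors into a sum
      over indices.\<close>
    then have "x = (\<Sum>j=1..n. scale (c (\<phi> j)) (\<phi> j))" using inj by (simp add: sum.reindex)
    then show "x \<in> {\<Sum>j=1..n. scale (a j) (\<phi> j) |a. True}"
      by (intro CollectI exI[of _ "\<lambda>j. c (\<phi> j)"]) simp
  next
    fix x assume "x \<in> {\<Sum>j=1..n. scale (a j) (\<phi> j) |a. True}"
    then obtain a where "x = (\<Sum>j=1..n. scale (a j) (\<phi> j))" by blast
    then show "x \<in> S" unfolding S
      by (simp only:) (intro span_sum span_scale span_base imageI)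
  qed
qed

lemma subspace_orthogonal: "subspace {v. ip f v = 0}"
  by (rule subspaceI) (simp_all add: ip_add_right ip_scale_right)

text \<open>The range is closed, hence the orthogonal complement of the null space of the adjoint,
  and orthogonality to a subspace can be tested on a basis.\<close>

lemma fredholm_solvable_iff:
  assumes A: "fredholm A" and \<psi>: "is_basis n \<psi> (null_space (adjoint A))"
  shows "(\<exists>u. A u = f) \<longleftrightarrow> (\<forall>j\<in>{1..n}. ip f (\<psi> j) = 0)"
proof -
  have "(\<exists>u. A u = f) \<longleftrightarrow> f \<in> range A" by auto
  also have "\<dots> \<longleftrightarrow> (\<forall>v\<in>null_space (adjoint A). ip f v = 0)"
    using range_eq_orthogonal_null_space_adjoint A unfolding fredholm_def by blast
  also have "\<dots> \<longleftrightarrow> span (\<psi> ` {1..n}) \<subseteq> {v. ip f v = 0}"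
    using \<psi> by (auto simp: is_basis_def)
  also have "\<dots> \<longleftrightarrow> \<psi> ` {1..n} \<subseteq> {v. ip f v = 0}"
    using span_superset[of "\<psi> ` {1..n}"] span_minimal[OF _ subspace_orthogonal] by blast
  finally show ?thesis by auto
qed

lemma general_solution:
  assumes A: "bounded_operator A" and \<phi>: "is_basis n \<phi> (null_space A)" and u: "A u\<^sub>p = f"
  shows "{u. A u = f} = {u\<^sub>p + (\<Sum>j=1..n. scale (a j) (\<phi> j)) |a. True}"
proof -
  interpret A: Vector_Spaces.linear scale scale A using A by (rule bounded_operator_linear)
  have "{u. A u = f} = (+) u\<^sub>p ` null_space A"
  proof (intro equalityI subsetI)
    fix x assume "x \<in> {u. A u = f}"
    then have "x - u\<^sub>p \<in> null_space A" using u by (simp add: null_space_def A.diff)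
    then show "x \<in> (+) u\<^sub>p ` null_space A" by (intro image_eqI[of _ _ "x - u\<^sub>p"]) auto
  qed (use u in \<open>auto simp: null_space_def A.add\<close>)
  then show ?thesis unfolding is_basis_combinations[OF \<phi>] by auto
qed

lemma solution_not_unique:
  assumes A: "bounded_operator A" and n: "dim (null_space A) > 0" and u: "A u\<^sub>p = f"
  shows "\<exists>u. A u = f \<and> u \<noteq> u\<^sub>p"
proof -
  interpret A: Vector_Spaces.linear scale scale A using A by (rule bounded_operator_linear)
  \<comment> \<open>A subspace of \<open>{0}\<close> is spanned by the empty set and would have
    dimension 0.\<close>
  have "\<not> null_space A \<subseteq> {0}"
    using n dim_le_card[of "null_space A" "{}"] by auto
  then obtain z where "A z = 0" "z \<noteq> 0" by (auto simp: null_space_def)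
  then show ?thesis using u by (intro exI[of _ "u\<^sub>p + z"]) (simp add: A.add)
qed

lemma fredholm_trivial_null_space:
  assumes A: "fredholm A" and n: "dim (null_space A) = 0"
  shows "A u = 0 \<longleftrightarrow> u = 0" and "\<exists>!u. A u = f"
proof -
  have bA: "bounded_operator A" using A by (simp add: fredholm_def)
  interpret A: Vector_Spaces.linear scale scale A using bA by (rule bounded_operator_linear)
  \<comment> \<open>Finite dimensionality enters here because \<open>dim\<close> is also 0 on
    infinite-dimensional subspaces.\<close>
  have trivial: "null_space T = {0}"
    if "fredholm T" "dim (null_space T) = 0" for T
  proof -
    have "finite_dim (null_space T)" "subspace (null_space T)"
      using that by (auto simp: fredholm_def subspace_null_space)
    then obtain b where "finite b" "span b = null_space T" "card b = dim (null_space T)"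
      by (rule finite_dim_basis)
    then show ?thesis using that(2) by auto
  qed
  show *: "A u = 0 \<longleftrightarrow> u = 0" for u using trivial[OF A n] by (auto simp: null_space_def)
  \<comment> \<open>Equality of the two dimensions carries uniqueness over to the adjoint, and the
    closed range is then the whole space.\<close>
  have "null_space (adjoint A) = {0}"
    using trivial[OF fredholm_adjoint[OF A]] A n by (simp add: fredholm_def)
  then have "f \<in> range A"
    using A by (simp add: fredholm_def range_eq_orthogonal_null_space_adjoint[OF bA])
  then obtain u where u: "A u = f" by blast
  have "v = u" if "A v = f" for v
    using that u *[of "v - u"] by (simp add: A.diff)
  with u show "\<exists>!u. A u = f" by blast
qed

end

theorem theorem1p1:
  fixes scale :: "'k::real_complex_field \<Rightarrow> 'a::banach \<Rightarrow> 'a"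
    and ip :: "'a \<Rightarrow> 'a \<Rightarrow> 'k"
    and A :: "'a \<Rightarrow> 'a"
  assumes H: "hilbert_space scale ip"
    and A: "hilbert_space.bounded_operator scale A"
  shows
    "(\<forall>B F. hilbert_space.isomorphism scale B \<and> hilbert_space.finite_rank scale F \<and>
        A = (\<lambda>x. B x + F x) \<longrightarrow> hilbert_space.fredholm scale ip A)
     \<and>
     (hilbert_space.fredholm scale ip A \<longrightarrow>
        ((\<forall>u. A u = 0 \<longrightarrow> u = 0) \<and>
         (\<forall>v. hilbert_space.adjoint ip A v = 0 \<longrightarrow> v = 0) \<and>
         (\<forall>f. \<exists>!u. A u = f) \<and>
         (\<forall>g. \<exists>!v. hilbert_space.adjoint ip A v = g))
        \<or>
        (\<exists>n>0.
           vector_space.dim scale (hilbert_space.null_space A) = n \<and>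
           vector_space.dim scale (hilbert_space.null_space (hilbert_space.adjoint ip A)) = n \<and>
           (\<exists>\<phi>. hilbert_space.is_basis scale n \<phi> (hilbert_space.null_space A)) \<and>
           (\<exists>\<psi>. hilbert_space.is_basis scale n \<psi>
                  (hilbert_space.null_space (hilbert_space.adjoint ip A))) \<and>
           (\<forall>\<phi> \<psi>.
              hilbert_space.is_basis scale n \<phi> (hilbert_space.null_space A) \<and>
              hilbert_space.is_basis scale n \<psi>
                (hilbert_space.null_space (hilbert_space.adjoint ip A)) \<longrightarrow>
              (\<forall>f. (\<exists>u. A u = f) \<longleftrightarrow> (\<forall>j\<in>{1..n}. ip f (\<psi> j) = 0)) \<and>
              (\<forall>g. (\<exists>v. hilbert_space.adjoint ip A v = g) \<longleftrightarrow>
                   (\<forall>j\<in>{1..n}. ip g (\<phi> j) = 0)) \<and>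
              (\<forall>f u\<^sub>p. A u\<^sub>p = f \<longrightarrow>
                 (\<exists>u. A u = f \<and> u \<noteq> u\<^sub>p) \<and>
                 {u. A u = f} = {u\<^sub>p + (\<Sum>j=1..n. scale (a j) (\<phi> j)) |a. True}) \<and>
              (\<forall>g v\<^sub>p. hilbert_space.adjoint ip A v\<^sub>p = g \<longrightarrow>
                 (\<exists>v. hilbert_space.adjoint ip A v = g \<and> v \<noteq> v\<^sub>p) \<and>
                 {v. hilbert_space.adjoint ip A v = g} =
                   {v\<^sub>p + (\<Sum>j=1..n. scale (b j) (\<psi> j)) |b. True}))))"
proof -
  interpret hilbert_space scale ip by fact
  note bA' = bounded_operator_adjoint[OF A]
  show ?thesis (is "?I \<and> (_ \<longrightarrow> ?alt1 \<or> ?alt2)")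
  proof (intro conjI impI)
    show ?I using isomorphism_plus_finite_rank_fredholm by blast
  next
    assume f: "fredholm A"
    note f' = fredholm_adjoint[OF f]
    have dims: "dim (null_space (adjoint A)) = dim (null_space A)"
      using f by (simp add: fredholm_def)
    show "?alt1 \<or> ?alt2"
    \<comment> \<open>Both null spaces share one finite dimension: 0 gives the first alternative,
      and any other value serves as \<open>n\<close> in the second.\<close>
    proof (cases "dim (null_space A) = 0")
      case True
      then have "dim (null_space (adjoint A)) = 0" using dims by simp
      from fredholm_trivial_null_space[OF f True] fredholm_trivial_null_space[OF f' this]
      have ?alt1 by blast
      then show ?thesis ..
    next
      case False
      then have pos: "dim (null_space A) > 0" "dim (null_space (adjoint A)) > 0" using dims by auto
      have ex: "\<exists>\<phi>. is_basis (dim (null_space A)) \<phi> (null_space A)"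
        "\<exists>\<psi>. is_basis (dim (null_space A)) \<psi> (null_space (adjoint A))"
        using is_basis_exists[OF _ subspace_null_space[OF A]]
          is_basis_exists[OF _ subspace_null_space[OF bA']] f dims
        by (auto simp: fredholm_def)
      \<comment> \<open>Solvability for \<open>adjoint A\<close> is the same criterion applied to
        \<open>adjoint A\<close>, whose adjoint is \<open>A\<close>, so \<phi> takes the place of
        \<psi>.\<close>
      have ?alt2
        using pos(1) dims ex fredholm_solvable_iff[OF f]
          fredholm_solvable_iff[OF f', unfolded adjoint_adjoint[OF A]]
          general_solution[OF A] general_solution[OF bA']
        by (intro exI[of _ "dim (null_space A)"] conjI allI impI)
          (simp_all add: solution_not_unique[OF A pos(1)] solution_not_unique[OF bA' pos(2)])
      then show ?thesis ..
    qed
  qed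
qed

end
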